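(* Let $b\in B_n$ be a positive braid on $n$ strands. The MFW inequality is sharp for the closure $\widehat{b}$, that is, $MFW(\widehat b)=n$, if and only if one (hence all) of the positive braid words in $\sigma_1,\dots,\sigma_{n-1}$ representing $b$ can be obtained from the empty word by a finite sequence of transformations of the following types: 1. inserting $\sigma_i^2$ (at any place in the word) for some $i=1,\dots,n-1$; 2. doubling a letter $\sigma_i$ (replacing an occurrence of $\sigma_i$ by $\sigma_i\sigma_i$) for some $i=1,\dots,n-1$; 3. applying positive braid relations.
   Context: $B_n$ is the braid group on $n$ strands with standard generators $\sigma_1,\dots,\sigma_{n-1}$, where $\sigma_i$ is a positive crossing; $\widehat{b}$ denotes the oriented link obtained as the closure of $b\in B_n$. A positive word is a (possibly empty) word in the letters $\sigma_i$ with no inverses, and a braid is positive if it is represented by a positive word. Applying a positive braid relation to a positive word means replacing a subword by an equal one using $\sigma_i\sigma_j=\sigma_j\sigma_i$ ($|i-j|\ge2$) or $\sigma_i\sigma_{i+1}\sigma_i=\sigma_{i+1}\sigma_i\sigma_{i+1}$, in either direction. The Homflypt polynomial $P(L)=P_L(v,z)\in\mathbb{Z}[v^{\pm1},z^{\pm1}]$ is the isotopy invariant of oriented links determined by $P(\text{unknot})=1$ and the skein relation $v^{-1}P(L_+)-vP(L_-)=zP(L_0)$, where $L_+,L_-,L_0$ differ only near one crossing, which is respectively positive, negative, and smoothed according to orientation. $\partial_v^+(P(L))$ and $\partial_v^-(P(L))$ denote the highest and lowest $v$-degrees of $P(L)$, and $$MFW(L)=\frac{\partial_v^+(P(L))-\partial_v^-(P(L))}{2}+1.$$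 The Morton-Franks-Williams (MFW) inequality states that $MFW(\widehat b)\le n$ for every $b\in B_n$; it is sharp for the closure of $b$ if $MFW(\widehat b)=n$. *)

theory Defs
  imports Complex_Main "HOL-Library.Poly_Mapping" "HOL-Library.Product_Plus"
begin

section \<open>Oriented link diagrams\<close>

text \<open>
  An oriented link diagram is put in general position with respect to the height function, so
  that it is a stack of elementary slices, listed from bottom to top. A slice \<open>(i, e)\<close> consists
  of one elementary piece \<open>e\<close> (local minimum, local maximum or crossing) with exactly \<open>i\<close>
  vertical strands to its left. A horizontal level that meets no critical point or crossing is
  described by the list of the orientations of its strands from left to right, \<open>True\<close> meaning
  upward.

  \<open>Cup u\<close> is a local minimum whose left branch has orientation \<open>u\<close>. In \<open>Cross r\<close>, the strand
  running from bottom left to top right is the overstrand iff \<open>r\<close>.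
\<close>

datatype piece = Cup bool | Cap | Cross bool

type_synonym diagram = "(nat \<times> piece) list"

inductive slice :: "bool list \<Rightarrow> nat \<times> piece \<Rightarrow> bool list \<Rightarrow> bool" where
  cup: "slice (xs @ ys) (length xs, Cup u) (xs @ [u, \<not> u] @ ys)"
| cap: "slice (xs @ [u, \<not> u] @ ys) (length xs, Cap) (xs @ ys)"
| cross: "slice (xs @ [p, q] @ ys) (length xs, Cross r) (xs @ [q, p] @ ys)"

inductive tangle :: "bool list \<Rightarrow> diagram \<Rightarrow> bool list \<Rightarrow> bool" where
  Nil: "tangle s [] s"
| Cons: "slice s a t \<Longrightarrow> tangle t D u \<Longrightarrow> tangle s (a # D) u"

definition link_diagram :: "diagram \<Rightarrow> bool" where
  "link_diagram D \<longleftrightarrow> tangle [] D []"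

section \<open>Isotopy\<close>

fun ins :: "piece \<Rightarrow> nat" where
  "ins (Cup u) = 0"
| "ins Cap = 2"
| "ins (Cross r) = 2"

fun outs :: "piece \<Rightarrow> nat" where
  "outs (Cup u) = 2"
| "outs Cap = 0"
| "outs (Cross r) = 2"

text \<open>
  The first five rules generate planar isotopy of diagrams: exchanging the heights of two pieces
  that lie side by side, straightening a zigzag, and sliding a strand over or under a local
  maximum or minimum. The others are the three Reidemeister moves. In \<open>R3\<close> the side condition
  says that the three strands are not cyclically above each other.
\<close>

inductive local_move :: "diagram \<Rightarrow> diagram \<Rightarrow> bool" where
  exchange: "local_move [(i, e), (i + outs e + k, f)] [(i + ins e + k, f), (i, e)]"
| zigzag_left: "local_move [(i, Cup u), (Suc i, Cap)] []"
| zigzag_right: "local_move [(Suc i, Cup u), (i, Cap)] []"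
| slide_cap: "local_move [(i, Cross r), (Suc i, Cap)] [(Suc i, Cross (\<not> r)), (i, Cap)]"
| slide_cup: "local_move [(i, Cup u), (Suc i, Cross r)] [(Suc i, Cup u'), (i, Cross (\<not> r))]"
| R1_cap: "local_move [(i, Cross r), (i, Cap)] [(i, Cap)]"
| R1_cup: "local_move [(i, Cup u), (i, Cross r)] [(i, Cup (\<not> u))]"
| R2: "local_move [(i, Cross r), (i, Cross (\<not> r))] []"
| R3: "q = p \<or> q = r \<Longrightarrow>
    local_move [(i, Cross p), (Suc i, Cross q), (i, Cross r)]
               [(Suc i, Cross r), (i, Cross q), (Suc i, Cross p)]"

text \<open>
  A local move replaces an oriented tangle by an oriented tangle with the same ends; this is what
  ties \<open>u'\<close> to \<open>u\<close> in \<open>slide_cup\<close>.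
\<close>

inductive move :: "diagram \<Rightarrow> diagram \<Rightarrow> bool" where
  "tangle [] X s \<Longrightarrow> tangle s A t \<Longrightarrow> tangle s B t \<Longrightarrow> tangle t Y [] \<Longrightarrow> local_move A B \<Longrightarrow>
   move (X @ A @ Y) (X @ B @ Y)"

text \<open>
  By the theorem of Reidemeister, oriented links up to isotopy are link diagrams up to these
  moves; a link is the class of its diagrams.
\<close>

definition isotopic :: "diagram \<Rightarrow> diagram \<Rightarrow> bool" where
  "isotopic = equivclp move"

type_synonym link = "diagram set"

definition link_of :: "diagram \<Rightarrow> link" where
  "link_of D = {D'. isotopic D D'}"

definition unknot :: link where
  "unknot = link_of [(0, Cup True), (0, Cap)]"

section \<open>The Homflypt polynomial\<close>

text \<open>
  The ring of Laurent polynomials in \<open>v\<close> and \<open>z\<close> with integer coefficients is the group ring of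
  the additive group of pairs of integers: the key \<open>(k, l)\<close> is the monomial with exponent \<open>k\<close>
  in \<open>v\<close> and \<open>l\<close> in \<open>z\<close>.
\<close>

type_synonym laurent = "(int \<times> int) \<Rightarrow>\<^sub>0 int"

definition lv :: laurent where "lv = Poly_Mapping.single (1, 0) 1"
definition lv_inv :: laurent where "lv_inv = Poly_Mapping.single (- 1, 0) 1"
definition lz :: laurent where "lz = Poly_Mapping.single (0, 1) 1"

text \<open>
  A crossing whose strands have the orientations \<open>p\<close>, \<open>q\<close> below it (left, right) is positive for
  \<open>Cross True\<close> if \<open>p = q\<close> and for \<open>Cross False\<close> otherwise. Smoothing it according to the
  orientation gives two vertical strands if \<open>p = q\<close>, and a maximum below a minimum otherwise.
\<close>

definition smoothing :: "bool \<Rightarrow> bool \<Rightarrow> nat \<Rightarrow> diagram" where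
  "smoothing p q i = (if p = q then [] else [(i, Cap), (i, Cup q)])"

inductive skein_triple :: "diagram \<Rightarrow> diagram \<Rightarrow> diagram \<Rightarrow> bool" where
  "tangle [] X (xs @ [p, q] @ ys) \<Longrightarrow> tangle (xs @ [q, p] @ ys) Y [] \<Longrightarrow> i = length xs \<Longrightarrow>
   skein_triple (X @ [(i, Cross (p = q))] @ Y) (X @ [(i, Cross (p \<noteq> q))] @ Y)
                (X @ smoothing p q i @ Y)"

definition homflypt :: "(link \<Rightarrow> laurent) \<Rightarrow> bool" where
  "homflypt P \<longleftrightarrow> P unknot = 1 \<and>
     (\<forall>D_pos D_neg D_zero. skein_triple D_pos D_neg D_zero \<longrightarrow>
        lv_inv * P (link_of D_pos) - lv * P (link_of D_neg) = lz * P (link_of D_zero))"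

definition max_v_degree :: "laurent \<Rightarrow> int" where
  "max_v_degree p = Max (fst ` Poly_Mapping.keys p)"

definition min_v_degree :: "laurent \<Rightarrow> int" where
  "min_v_degree p = Min (fst ` Poly_Mapping.keys p)"

definition MFW :: "(link \<Rightarrow> laurent) \<Rightarrow> link \<Rightarrow> rat" where
  "MFW P L = of_int (max_v_degree (P L) - min_v_degree (P L)) / 2 + 1"

section \<open>Braids\<close>

inductive artin :: "nat list \<Rightarrow> nat list \<Rightarrow> bool" where
  far: "i + 2 \<le> j \<or> j + 2 \<le> i \<Longrightarrow> artin [i, j] [j, i]"
| braid: "artin [i, Suc i, i] [Suc i, i, Suc i]"

text \<open>
  The letter \<open>(i, True)\<close> is the generator number \<open>i\<close> and \<open>(i, False)\<close> is its inverse. The elements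
  of the braid group on \<open>n\<close> strands are the classes of words for the group presentation with
  generators \<open>1, \<dots>, n - 1\<close> and the Artin relations.
\<close>

type_synonym braid_word = "(nat \<times> bool) list"

definition pos :: "nat list \<Rightarrow> braid_word" where
  "pos w = map (\<lambda>i. (i, True)) w"

definition braid_words :: "nat \<Rightarrow> braid_word set" where
  "braid_words n = {w. fst ` set w \<subseteq> {1..<n}}"

inductive braid_relation :: "braid_word \<Rightarrow> braid_word \<Rightarrow> bool" where
  cancel: "braid_relation [(i, e), (i, \<not> e)] []"
| artin: "artin u w \<Longrightarrow> braid_relation (pos u) (pos w)"

inductive braid_step :: "nat \<Rightarrow> braid_word \<Rightarrow> braid_word \<Rightarrow> bool" for n where
  "braid_relation a b \<Longrightarrow> x @ a @ y \<in> braid_words n \<Longrightarrow> x @ b @ y \<in> braid_words n \<Longrightarrow>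
   braid_step n (x @ a @ y) (x @ b @ y)"

type_synonym braid = "braid_word set"

definition braid_of :: "nat \<Rightarrow> braid_word \<Rightarrow> braid" where
  "braid_of n w = {w'. equivclp (braid_step n) w w'}"

definition braid_group :: "nat \<Rightarrow> braid set" where
  "braid_group n = braid_of n ` braid_words n"

definition positive_words :: "nat \<Rightarrow> nat list set" where
  "positive_words n = {w. set w \<subseteq> {1..<n}}"

definition positive_words_of :: "nat \<Rightarrow> braid \<Rightarrow> nat list set" where
  "positive_words_of n b = {w \<in> positive_words n. braid_of n (pos w) = b}"

definition positive_braid :: "nat \<Rightarrow> braid \<Rightarrow> bool" where
  "positive_braid n b \<longleftrightarrow> b \<in> braid_group n \<and> positive_words_of n b \<noteq> {}"

text \<open>
  The strands of a braid run upward; the closing strands are nested arcs on its right.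
\<close>

definition closure_diagram :: "nat \<Rightarrow> braid_word \<Rightarrow> diagram" where
  "closure_diagram n w =
     map (\<lambda>k. (k, Cup True)) [0..<n] @
     map (\<lambda>(i, e). (i - 1, Cross e)) w @
     map (\<lambda>k. (k, Cap)) (rev [0..<n])"

text \<open>
  All words of a braid have isotopic closures, so the union is the class of any one of them;
  see \<open>braid_closure_eq\<close> below.
\<close>

definition braid_closure :: "nat \<Rightarrow> braid \<Rightarrow> link" where
  "braid_closure n b = (\<Union>w\<in>b. link_of (closure_diagram n w))"

section \<open>Transformations of positive words\<close>

inductive positive_relation :: "nat list \<Rightarrow> nat list \<Rightarrow> bool" where
  "artin a b \<or> artin b a \<Longrightarrow> positive_relation (x @ a @ y) (x @ b @ y)"

inductive obtainable :: "nat \<Rightarrow> nat list \<Rightarrow> bool" for n where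
  empty: "obtainable n []"
| insert: "obtainable n (x @ y) \<Longrightarrow> 1 \<le> i \<Longrightarrow> i < n \<Longrightarrow> obtainable n (x @ [i, i] @ y)"
| double: "obtainable n (x @ [i] @ y) \<Longrightarrow> obtainable n (x @ [i, i] @ y)"
| relation: "obtainable n w \<Longrightarrow> positive_relation w w' \<Longrightarrow> obtainable n w'"

section \<open>The closure of a braid is well defined\<close>

lemma tangle_append: "tangle s D t \<Longrightarrow> tangle t E u \<Longrightarrow> tangle s (D @ E) u"
  by (induction rule: tangle.induct) (auto intro: tangle.intros)

lemma replicate_middle: "replicate n True @ [True, \<not> True] @ replicate n False =
    replicate (Suc n) True @ replicate (Suc n) False"
  by (simp add: replicate_app_Cons_same)

lemma tangle_single: "slice s a t \<Longrightarrow> tangle s [a] t"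
  by (rule tangle.Cons[OF _ tangle.Nil])

lemma tangle_cups: "tangle [] (map (\<lambda>k. (k, Cup True)) [0..<n]) (replicate n True @ replicate n False)"
proof (induction n)
  case 0
  show ?case by (simp add: tangle.Nil)
next
  case (Suc n)
  have "slice (replicate n True @ replicate n False) (n, Cup True)
          (replicate (Suc n) True @ replicate (Suc n) False)"
    using slice.cup[of "replicate n True" "replicate n False" True]
    unfolding replicate_middle length_replicate .
  from tangle_append[OF Suc tangle_single[OF this]] show ?case by simp
qed

lemma tangle_caps: "tangle (replicate n True @ replicate n False) (map (\<lambda>k. (k, Cap)) (rev [0..<n])) []"
proof (induction n)
  case 0
  show ?case by (simp add: tangle.Nil)
next
  case (Suc n)
  have "slice (replicate (Suc n) True @ replicate (Suc n) False) (n, Cap)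
          (replicate n True @ replicate n False)"
    using slice.cap[of "replicate n True" True "replicate n False"]
    unfolding replicate_middle length_replicate .
  from tangle.Cons[OF this Suc] show ?case by simp
qed

lemma tangle_braid:
  assumes "w \<in> braid_words n"
  shows "tangle (replicate n True @ replicate n False) (map (\<lambda>(i, e). (i - 1, Cross e)) w)
           (replicate n True @ replicate n False)"
  using assms
proof (induction w)
  case Nil
  show ?case by (simp add: tangle.Nil)
next
  case (Cons a w)
  obtain i e where a: "a = (i, e)" by force
  have i: "1 \<le> i" "i < n" and w: "w \<in> braid_words n"
    using Cons.prems by (auto simp: braid_words_def a)
  have eq: "replicate n True @ replicate n False =
      replicate (i - 1) True @ [True, True] @ (replicate (n - i - 1) True @ replicate n False)"
  proof -
    have "n = (i - 1) + (2 + (n - i - 1))" using i by simp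
    then have "replicate n True = replicate (i - 1) True @ replicate 2 True @ replicate (n - i - 1) True"
      by (metis replicate_add)
    then show ?thesis by (simp add: numeral_2_eq_2)
  qed
  have "slice (replicate n True @ replicate n False) (i - 1, Cross e)
          (replicate n True @ replicate n False)"
    using slice.cross[of "replicate (i - 1) True" True True _ e] unfolding eq by simp
  then show ?case using Cons.IH[OF w] by (auto simp: a intro: tangle.intros)
qed

lemma link_diagram_closure: "w \<in> braid_words n \<Longrightarrow> link_diagram (closure_diagram n w)"
  unfolding link_diagram_def closure_diagram_def
  by (rule tangle_append[OF tangle_cups tangle_append[OF tangle_braid tangle_caps]])

lemma isotopic_sym: "isotopic D E \<Longrightarrow> isotopic E D"
  unfolding isotopic_def by (rule equivclp_sym)

lemma isotopic_trans: "isotopic D E \<Longrightarrow> isotopic E F \<Longrightarrow> isotopic D F"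
  unfolding isotopic_def by (rule equivclp_trans)

lemma link_of_eq_iff: "link_of D = link_of E \<longleftrightarrow> isotopic D E"
proof
  assume "link_of D = link_of E"
  moreover have "isotopic E E" by (simp add: isotopic_def)
  ultimately show "isotopic D E" by (auto simp: link_of_def)
next
  assume "isotopic D E"
  then show "link_of D = link_of E"
    unfolding link_of_def by (blast intro: isotopic_sym isotopic_trans)
qed

lemma braid_relation_local_move:
  assumes "braid_relation a b" "fst ` set a \<subseteq> {1..}"
  defines "f \<equiv> map (\<lambda>(i, e). (i - 1, Cross e))"
  shows "local_move (f a) (f b) \<or> local_move (f b) (f a)"
  using assms(1)
proof cases
  case (cancel i e)
  then show ?thesis by (simp add: f_def local_move.R2)
next
  case (artin u w)
  from artin(3) show ?thesis
  proof cases
    case (far i j)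
    have *: "local_move [(k, Cross True), (l, Cross True)] [(l, Cross True), (k, Cross True)]"
      if "k + 2 \<le> l" for k l
    proof -
      have "l = k + 2 + (l - k - 2)" using that by simp
      then show ?thesis
        using local_move.exchange[of k "Cross True" "l - k - 2" "Cross True"] by (metis ins.simps(3) outs.simps(3))
    qed
    have ge: "1 \<le> i" "1 \<le> j" using assms(2) artin far by (auto simp: pos_def)
    from far(3) show ?thesis
    proof
      assume "i + 2 \<le> j"
      then have "i - 1 + 2 \<le> j - 1" using ge by simp
      from *[OF this] show ?thesis by (simp add: f_def artin far pos_def)
    next
      assume "j + 2 \<le> i"
      then have "j - 1 + 2 \<le> i - 1" using ge by simp
      from *[OF this] show ?thesis by (simp add: f_def artin far pos_def)
    qed
  next
    case (braid i)
    have "1 \<le> i" using assms(2) artin braid by (auto simp: pos_def)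
    then have "Suc (i - 1) = i" by simp
    then show ?thesis
      using local_move.R3[of True True True "i - 1"] by (simp add: f_def artin braid pos_def)
  qed
qed

lemma braid_step_isotopic:
  assumes "braid_step n w w'"
  shows "isotopic (closure_diagram n w) (closure_diagram n w')"
  using assms
proof cases
  case (1 a b x y)
  let ?s = "replicate n True @ replicate n False"
  let ?f = "map (\<lambda>(i, e). (i - 1, Cross e))"
  let ?X = "map (\<lambda>k. (k, Cup True)) [0..<n] @ ?f x"
  let ?Y = "?f y @ map (\<lambda>k. (k, Cap)) (rev [0..<n])"
  have w: "a \<in> braid_words n" "b \<in> braid_words n" "x \<in> braid_words n" "y \<in> braid_words n"
    using 1 by (auto simp: braid_words_def image_Un)
  have X: "tangle [] ?X ?s" using tangle_append[OF tangle_cups tangle_braid[OF w(3)]] .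
  have Y: "tangle ?s ?Y []" using tangle_append[OF tangle_braid[OF w(4)] tangle_caps] .
  have "fst ` set a \<subseteq> {1..}" using w by (auto simp: braid_words_def)
  from braid_relation_local_move[OF 1(3) this]
  have "move (?X @ ?f a @ ?Y) (?X @ ?f b @ ?Y) \<or> move (?X @ ?f b @ ?Y) (?X @ ?f a @ ?Y)"
    using move.intros[OF X tangle_braid tangle_braid Y] w by blast
  moreover have "?X @ ?f a @ ?Y = closure_diagram n w" "?X @ ?f b @ ?Y = closure_diagram n w'"
    by (simp_all add: 1 closure_diagram_def)
  ultimately have "move (closure_diagram n w) (closure_diagram n w') \<or>
      move (closure_diagram n w') (closure_diagram n w)" by simp
  then show ?thesis
    unfolding isotopic_def by (auto intro: r_into_equivclp converse_r_into_equivclp)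
qed

lemma braid_eq_isotopic:
  assumes "equivclp (braid_step n) w w'"
  shows "isotopic (closure_diagram n w) (closure_diagram n w')"
  using assms
proof (induction rule: equivclp_induct)
  case base
  show ?case by (simp add: isotopic_def)
next
  case (step w' w'')
  then show ?case using braid_step_isotopic isotopic_sym isotopic_trans by blast
qed

lemma braid_closure_eq: "braid_closure n (braid_of n w) = link_of (closure_diagram n w)"
proof -
  have "link_of (closure_diagram n w') = link_of (closure_diagram n w)" if "w' \<in> braid_of n w" for w'
    using that braid_eq_isotopic isotopic_sym by (simp add: braid_of_def link_of_eq_iff)
  moreover have "w \<in> braid_of n w" by (simp add: braid_of_def)
  ultimately show ?thesis unfolding braid_closure_def by blast
qed

end

theory Submission
  imports Defs
begin

text \<open>
  For a positive word \<open>w\<close> of length \<open>c\<close> on \<open>n\<close> strands, the \<open>v\<close>-degrees of the Homflypt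
  polynomial of the closure lie between \<open>c - (n - 1)\<close> and \<open>c + (n - 1)\<close>, and the lower bound is
  always attained. So sharpness of the MFW inequality means that the coefficient of
  \<open>v ^ (c + n - 1)\<close>, the highest coefficient, does not vanish.

  The skein relation at one crossing of a square, \<open>P(x i i y) = v^2 P(x y) + v z P(x i y)\<close>, shows
  that both extreme coefficients satisfy the same recursion \<open>t(x i i y) = t(x y) + z t(x i y)\<close>.
  Iterating it leads to words with no square in their class under the positive braid relations.
  Such a word is equivalent to one that contains the last generator at most once
  (\<open>square_or_at_most_once\<close>), so that the last strand can be removed. If the generator does not
  occur, the closure is a split union with an unknot and \<open>z P = (1/v - v) P'\<close>, where \<open>P'\<close>
  belongs to the word on one strand less: up to the power of \<open>z\<close> the lowest coefficient is kept
  and the highest one changes sign. If it occurs once, a Markov destabilization shows \<open>P = P'\<close>; then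
  \<open>c\<close> and \<open>n\<close> both drop by one, so the lowest coefficient is kept and the highest one vanishes. By
  induction the lowest coefficient and \<open>(-1) ^ (n - 1)\<close> times the highest coefficient are Laurent
  polynomials in \<open>z\<close> with nonnegative coefficients, and the lowest one is nonzero.

  Nonnegativity excludes cancellation in the recursion, so the highest coefficient of \<open>x i i y\<close> is
  nonzero iff that of \<open>x y\<close> (inserting a square) or that of \<open>x i y\<close> (doubling a letter) is.
  Therefore the three transformations preserve nonvanishing, and in the other direction the
  reductions above trace a word with nonzero highest coefficient back to the empty word. Since the
  polynomial depends only on the braid, the criterion holds for all its words or for none.
\<close>

section \<open>Positive braid relations on words\<close>

lemma positive_relation_sym: "positive_relation u w \<Longrightarrow> positive_relation w u"
  by (metis positive_relation.simps)

lemma positive_relation_context: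
  assumes "positive_relation u w"
  shows "positive_relation (p @ u @ q) (p @ w @ q)"
  using assms
proof cases
  case (1 a b x y)
  then show ?thesis using positive_relation.intros[of a b "p @ x" "y @ q"] by simp
qed

lemma positive_relation_set: "positive_relation u w \<Longrightarrow> set w = set u"
  by (auto simp: positive_relation.simps artin.simps)

lemma positive_relation_length: "positive_relation u w \<Longrightarrow> length w = length u"
  by (auto simp: positive_relation.simps artin.simps)

lemma positive_equiv_context:
  "positive_relation\<^sup>*\<^sup>* u w \<Longrightarrow> positive_relation\<^sup>*\<^sup>* (p @ u @ q) (p @ w @ q)"
  by (induction rule: rtranclp_induct) (auto intro: rtranclp.rtrancl_into_rtrancl positive_relation_context)

lemma positive_equiv_sym: "positive_relation\<^sup>*\<^sup>* u w \<Longrightarrow> positive_relation\<^sup>*\<^sup>* w u"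
  by (induction rule: rtranclp_induct) (auto intro: converse_rtranclp_into_rtranclp positive_relation_sym)

lemma positive_equiv_set: "positive_relation\<^sup>*\<^sup>* u w \<Longrightarrow> set w = set u"
  by (induction rule: rtranclp_induct) (auto simp: positive_relation_set)

lemma positive_equiv_length: "positive_relation\<^sup>*\<^sup>* u w \<Longrightarrow> length w = length u"
  by (induction rule: rtranclp_induct) (auto simp: positive_relation_length)

lemma far_letter_commutes:
  assumes "\<forall>j\<in>set a. j + 2 \<le> i"
  shows "positive_relation\<^sup>*\<^sup>* (i # a) (a @ [i])"
  using assms
proof (induction a)
  case (Cons j a)
  have "positive_relation ([] @ [i, j] @ a) ([] @ [j, i] @ a)"
    by (rule positive_relation.intros) (use Cons.prems in \<open>auto intro: artin.far\<close>)
  moreover have "positive_relation\<^sup>*\<^sup>* (j # i # a) (j # a @ [i])"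
    using positive_equiv_context[of "i # a" "a @ [i]" "[j]" "[]"] Cons by simp
  ultimately show ?case by (simp add: converse_rtranclp_into_rtranclp)
qed simp

text \<open>
  Between two consecutive occurrences of the largest letter \<open>n\<close>, the induction on \<open>n\<close> leaves at most
  one \<open>n - 1\<close>. If there is none, the two occurrences commute into a square. If there is one, the
  rest commutes away from \<open>n\<close> and the braid relation turns \<open>n (n-1) n\<close> into \<open>(n-1) n (n-1)\<close>, which
  has fewer occurrences of \<open>n\<close>.
\<close>

lemma square_or_at_most_once:
  assumes "set w \<subseteq> {..n}"
  shows "(\<exists>x i y. positive_relation\<^sup>*\<^sup>* w (x @ [i, i] @ y)) \<or>
         (\<exists>w'. positive_relation\<^sup>*\<^sup>* w w' \<and> count_list w' n \<le> 1)"
  using assms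
proof (induction n arbitrary: w)
  case 0
  then have "w = replicate (length w) 0"
    by (metis atMost_0 replicate_eqI singletonD subsetD)
  then consider "count_list w 0 \<le> 1" | x where "w = [] @ [0, 0] @ x"
    by (cases w rule: remdups_adj.cases) auto
  then show ?case by cases blast+
next
  case (Suc n)
  define N where "N = Suc n"
  show ?case
    using Suc.prems
  proof (induction "count_list w (Suc n)" arbitrary: w rule: less_induct)
    case (less w)
    show ?case
    proof (cases "count_list w N \<le> 1")
      case False
      obtain x r where w1: "w = x @ N # r" "N \<notin> set x"
        using False by (metis count_notin split_list_first zero_le)
      then have "N \<in> set r"
        using False by (metis One_nat_def add_0 count_list.simps(2) count_list_append count_notin le_refl add.commute plus_1_eq_Suc)
      then obtain m y where r: "r = m @ N # y" "N \<notin> set m"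
        by (metis split_list_first)
      have w: "w = x @ ([N] @ m @ [N]) @ y" using w1 r by simp
      have m: "set m \<subseteq> {..n}"
      proof
        fix j assume "j \<in> set m"
        then have "j \<le> N" "j \<noteq> N" using less.prems r(2) by (auto simp: w N_def)
        then show "j \<in> {..n}" by (simp add: N_def)
      qed
      have lift: "positive_relation\<^sup>*\<^sup>* w (x @ u @ y)" if "positive_relation\<^sup>*\<^sup>* ([N] @ m @ [N]) u" for u
        unfolding w by (rule positive_equiv_context[OF that])
      from Suc.IH[OF m] show ?thesis
      proof
        assume "\<exists>p i q. positive_relation\<^sup>*\<^sup>* m (p @ [i, i] @ q)"
        then obtain p i q where "positive_relation\<^sup>*\<^sup>* m (p @ [i, i] @ q)" by blast
        from lift[OF positive_equiv_context[OF this]]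
        have "positive_relation\<^sup>*\<^sup>* w ((x @ [N] @ p) @ [i, i] @ (q @ [N] @ y))" by simp
        then show ?thesis by blast
      next
        assume "\<exists>m'. positive_relation\<^sup>*\<^sup>* m m' \<and> count_list m' n \<le> 1"
        then obtain m' where m': "positive_relation\<^sup>*\<^sup>* m m'" "count_list m' n \<le> 1" by blast
        have set_m': "set m' \<subseteq> {..n}" using m positive_equiv_set[OF m'(1)] by simp
        have to_m': "positive_relation\<^sup>*\<^sup>* ([N] @ m @ [N]) ([N] @ m' @ [N])"
          by (rule positive_equiv_context[OF m'(1)])
        have far: "\<forall>j\<in>set p. j + 2 \<le> N" if "set p \<subseteq> {..n}" "n \<notin> set p" for p
        proof
          fix j assume "j \<in> set p"
          then have "j \<le> n" "j \<noteq> n" using that by auto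
          then show "j + 2 \<le> N" by (simp add: N_def)
        qed
        show ?thesis
        proof (cases "n \<in> set m'")
          case False
          have "positive_relation\<^sup>*\<^sup>* ([] @ (N # m') @ [N]) ([] @ (m' @ [N]) @ [N])"
            by (rule positive_equiv_context[OF far_letter_commutes[OF far[OF set_m' False]]])
          then have "positive_relation\<^sup>*\<^sup>* ([N] @ m @ [N]) (m' @ [N, N])"
            using to_m' by simp
          from lift[OF this] have "positive_relation\<^sup>*\<^sup>* w ((x @ m') @ [N, N] @ y)" by simp
          then show ?thesis by blast
        next
          case True
          then obtain a b where m'_eq: "m' = a @ n # b" "n \<notin> set a"
            by (metis split_list_first)
          then have b: "n \<notin> set b"
            using m'(2) by (simp add: count_list_0_iff)
          have far_ab: "\<forall>j\<in>set a. j + 2 \<le> N" "\<forall>j\<in>set b. j + 2 \<le> N"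
            using far[of a] far[of b] set_m' m'_eq b by auto
          have "positive_relation\<^sup>*\<^sup>* ([] @ (N # a) @ n # b @ [N]) ([] @ (a @ [N]) @ n # b @ [N])"
            by (rule positive_equiv_context[OF far_letter_commutes[OF far_ab(1)]])
          moreover have "positive_relation\<^sup>*\<^sup>* ((a @ [N, n]) @ (b @ [N]) @ []) ((a @ [N, n]) @ (N # b) @ [])"
            by (rule positive_equiv_context[OF positive_equiv_sym[OF far_letter_commutes[OF far_ab(2)]]])
          moreover have "positive_relation (a @ [N, n, N] @ b) (a @ [n, N, n] @ b)"
            by (rule positive_relation.intros) (simp add: N_def artin.braid)
          ultimately have "positive_relation\<^sup>*\<^sup>* ([N] @ m' @ [N]) (a @ [n, N, n] @ b)"
            by (simp add: m'_eq)
          with to_m' have "positive_relation\<^sup>*\<^sup>* ([N] @ m @ [N]) (a @ [n, N, n] @ b)" by simp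
          from lift[OF this] have w': "positive_relation\<^sup>*\<^sup>* w (x @ (a @ [n, N, n] @ b) @ y)" .
          have "N \<notin> set m'" using set_m' by (auto simp: N_def)
          then have "count_list (x @ (a @ [n, N, n] @ b) @ y) (Suc n) < count_list w (Suc n)"
            using m'_eq by (simp add: w N_def)
          moreover have "set (x @ (a @ [n, N, n] @ b) @ y) \<subseteq> {..Suc n}"
            using positive_equiv_set[OF w'] less.prems by simp
          ultimately show ?thesis
            using less.hyps w' by (meson rtranclp_trans)
        qed
      qed
    qed (auto simp: N_def)
  qed
qed

text \<open>
  Positive words on \<open>Suc m\<close> strands have the letters \<open>1, \<dots>, m\<close>. Read backwards, the cases other than
  the braid relations are the steps in which the Homflypt polynomial of the closure can be reduced,
  and each of them decreases the sum of \<open>m\<close> and the length of the word.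
\<close>

lemma positive_word_induct [consumes 1, case_names empty relation square split stabilize]:
  assumes "set w \<subseteq> {1..m}"
    and empty: "Q 0 []"
    and relation: "\<And>m w w'. set w \<subseteq> {1..m} \<Longrightarrow> positive_relation w w' \<Longrightarrow> Q m w \<Longrightarrow> Q m w'"
    and square: "\<And>m x i y. set (x @ [i] @ y) \<subseteq> {1..m} \<Longrightarrow> Q m (x @ y) \<Longrightarrow> Q m (x @ [i] @ y) \<Longrightarrow>
        Q m (x @ [i, i] @ y)"
    and split: "\<And>m w. set w \<subseteq> {1..m} \<Longrightarrow> Q m w \<Longrightarrow> Q (Suc m) w"
    and stabilize: "\<And>m x y. set (x @ y) \<subseteq> {1..m} \<Longrightarrow> Q m (x @ y) \<Longrightarrow> Q (Suc m) (x @ [Suc m] @ y)"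
  shows "Q m w"
  using assms(1)
proof (induction "m + length w" arbitrary: m w rule: less_induct)
  case less
  have equiv: "Q m w" if "positive_relation\<^sup>*\<^sup>* w w'" "Q m w'" for w'
    using that
  proof (induction rule: rtranclp_induct)
    case (step u u')
    have "set u' \<subseteq> {1..m}"
      using less.prems positive_equiv_set[OF step(1)] positive_relation_set[OF step(2)] by simp
    then show ?case using step relation positive_relation_sym by blast
  qed
  show ?case
  proof (cases m)
    case 0
    then show ?thesis using less.prems empty by simp
  next
    case (Suc k)
    have "set w \<subseteq> {..m}" using less.prems by auto
    from square_or_at_most_once[OF this] show ?thesis
    proof (elim disjE exE conjE)
      fix x i y assume w: "positive_relation\<^sup>*\<^sup>* w (x @ [i, i] @ y)"
      have "length w = length x + length y + 2" and xiy: "set (x @ [i] @ y) \<subseteq> {1..m}"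
        using positive_equiv_length[OF w] positive_equiv_set[OF w] less.prems by auto
      then have "Q m (x @ y)" "Q m (x @ [i] @ y)"
        by (simp_all add: less.hyps)
      then show ?thesis using equiv[OF w] square[OF xiy] by blast
    next
      fix w' assume w: "positive_relation\<^sup>*\<^sup>* w w'" and count: "count_list w' m \<le> 1"
      have len: "length w' = length w" and set_w': "set w' \<subseteq> {1..m}"
        using positive_equiv_length[OF w] positive_equiv_set[OF w] less.prems by auto
      have below: "set u \<subseteq> {1..k}" if "set u \<subseteq> {1..m}" "m \<notin> set u" for u
        using that by (force simp: Suc le_Suc_eq)
      show ?thesis
      proof (cases "m \<in> set w'")
        case False
        then have "set w' \<subseteq> {1..k}" using below set_w' by blast
        then have "Q m w'" unfolding Suc by (intro split less.hyps) (auto simp: Suc len)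
        then show ?thesis by (rule equiv[OF w])
      next
        case True
        then obtain x y where w': "w' = x @ m # y" "m \<notin> set x" by (metis split_list_first)
        then have "m \<notin> set y" using count by (simp add: count_list_0_iff)
        then have xy: "set (x @ y) \<subseteq> {1..k}" using below[of "x @ y"] w' set_w' by auto
        then have "Q k (x @ y)" by (intro less.hyps) (use len w' Suc in auto)
        from stabilize[OF xy this] show ?thesis
          using equiv[OF w] w' Suc by simp
      qed
    qed
  qed
qed

lemma obtainable_positive: "obtainable n w \<Longrightarrow> set w \<subseteq> {1..<n}"
  by (induction rule: obtainable.induct) (auto simp: positive_relation_set)

lemma obtainable_more_strands: "obtainable n w \<Longrightarrow> n \<le> n' \<Longrightarrow> obtainable n' w"
proof (induction rule: obtainable.induct)
  case (insert x y i)
  then show ?case by (intro obtainable.insert) simp_all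
next
  case (double x i y)
  then show ?case by (intro obtainable.double) simp_all
qed (auto intro: obtainable.empty obtainable.relation)

section \<open>Isotopies of closed braid diagrams\<close>

text \<open>
  Single moves apply to complete link diagrams only. Isotopy of tangles with fixed ends is what one
  can transfer between contexts.
\<close>

definition tangle_isotopic :: "bool list \<Rightarrow> bool list \<Rightarrow> diagram \<Rightarrow> diagram \<Rightarrow> bool" where
  "tangle_isotopic s t A B \<longleftrightarrow> tangle s A t \<and> tangle s B t \<and>
     (\<forall>X Y. tangle [] X s \<longrightarrow> tangle t Y [] \<longrightarrow> isotopic (X @ A @ Y) (X @ B @ Y))"

lemma tangle_isotopic_refl: "tangle s A t \<Longrightarrow> tangle_isotopic s t A A"
  by (simp add: tangle_isotopic_def isotopic_def)

lemma tangle_isotopic_sym: "tangle_isotopic s t A B \<Longrightarrow> tangle_isotopic s t B A"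
  unfolding tangle_isotopic_def by (blast intro: isotopic_sym)

lemma tangle_isotopic_trans [trans]:
  "tangle_isotopic s t A B \<Longrightarrow> tangle_isotopic s t B C \<Longrightarrow> tangle_isotopic s t A C"
  unfolding tangle_isotopic_def by (blast intro: isotopic_trans)

lemma tangle_isotopic_move:
  assumes "tangle s A t" "tangle s B t" "local_move A B"
  shows "tangle_isotopic s t A B"
proof -
  have "isotopic (X @ A @ Y) (X @ B @ Y)" if "tangle [] X s" "tangle t Y []" for X Y
    unfolding isotopic_def using move.intros[OF that(1) assms(1,2) that(2) assms(3)] by blast
  then show ?thesis using assms by (simp add: tangle_isotopic_def)
qed

lemma tangle_isotopic_context:
  assumes "tangle r C s" "tangle_isotopic s t A B" "tangle t E u"
  shows "tangle_isotopic r u (C @ A @ E) (C @ B @ E)"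
  unfolding tangle_isotopic_def
proof (intro conjI allI impI)
  show "tangle r (C @ A @ E) u" "tangle r (C @ B @ E) u"
    using assms by (auto simp: tangle_isotopic_def intro: tangle_append)
  fix X Y assume "tangle [] X r" "tangle u Y []"
  then have "tangle [] (X @ C) s" "tangle t (E @ Y) []"
    using assms by (auto intro: tangle_append)
  then have "isotopic ((X @ C) @ A @ (E @ Y)) ((X @ C) @ B @ (E @ Y))"
    using assms(2) by (simp only: tangle_isotopic_def)
  then show "isotopic (X @ (C @ A @ E) @ Y) (X @ (C @ B @ E) @ Y)" by simp
qed

abbreviation closed_level :: "nat \<Rightarrow> bool list" where
  "closed_level n \<equiv> replicate n True @ replicate n False"

abbreviation crossings :: "braid_word \<Rightarrow> diagram" where
  "crossings w \<equiv> map (\<lambda>(i, e). (i - 1, Cross e)) w"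

lemma tangle_cup: "tangle (closed_level n) [(n, Cup True)] (closed_level (Suc n))"
  using slice.cup[of "replicate n True" "replicate n False" True]
  unfolding replicate_middle length_replicate by (rule tangle_single)

lemma tangle_cap: "tangle (closed_level (Suc n)) [(n, Cap)] (closed_level n)"
  using slice.cap[of "replicate n True" True "replicate n False"]
  unfolding replicate_middle length_replicate by (rule tangle_single)

lemma braid_words_mono: "n \<le> n' \<Longrightarrow> w \<in> braid_words n \<Longrightarrow> w \<in> braid_words n'"
  by (auto simp: braid_words_def)

text \<open>
  The innermost closing arc belongs to the last strand, so it slides along a braid word that does
  not involve this strand.
\<close>

lemma cup_past_crossings:
  assumes "x \<in> braid_words n"
  shows "tangle_isotopic (closed_level n) (closed_level (Suc n))
           ((n, Cup True) # crossings x) (crossings x @ [(n, Cup True)])"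
  using assms
proof (induction x)
  case Nil
  show ?case using tangle_isotopic_refl[OF tangle_cup] by simp
next
  case (Cons a x)
  obtain i e where a: "a = (i, e)" by force
  have i: "1 \<le> i" "i < n" and x: "x \<in> braid_words n" and ie: "[(i, e)] \<in> braid_words n"
    using Cons.prems by (auto simp: braid_words_def a)
  have c: "tangle (closed_level k) [(i - 1, Cross e)] (closed_level k)" if "n \<le> k" for k
    using tangle_braid[OF braid_words_mono[OF that ie]] by simp
  have "local_move [(i - 1, Cross e), (n, Cup True)] [(n, Cup True), (i - 1, Cross e)]"
    using local_move.exchange[of "i - 1" "Cross e" "n - i - 1" "Cup True"] i by simp
  then have 1: "tangle_isotopic (closed_level n) (closed_level (Suc n))
      [(i - 1, Cross e), (n, Cup True)] [(n, Cup True), (i - 1, Cross e)]"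
    using tangle_append[OF c tangle_cup, of n] tangle_append[OF tangle_cup c, of n]
    by (intro tangle_isotopic_move) auto
  have "tangle_isotopic (closed_level n) (closed_level (Suc n))
      ((n, Cup True) # (i - 1, Cross e) # crossings x)
      ((i - 1, Cross e) # (n, Cup True) # crossings x)"
    using tangle_isotopic_context[OF tangle.Nil tangle_isotopic_sym[OF 1]
        tangle_braid[OF braid_words_mono[OF _ x]]] by simp
  also have "tangle_isotopic (closed_level n) (closed_level (Suc n))
      ((i - 1, Cross e) # (n, Cup True) # crossings x)
      ((i - 1, Cross e) # crossings x @ [(n, Cup True)])"
    using tangle_isotopic_context[OF c[OF order_refl] Cons.IH[OF x] tangle.Nil] by simp
  finally show ?case by (simp add: a)
qed

lemma cap_past_crossings:
  assumes "x \<in> braid_words n"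
  shows "tangle_isotopic (closed_level (Suc n)) (closed_level n)
           (crossings x @ [(n, Cap)]) ((n, Cap) # crossings x)"
  using assms
proof (induction x)
  case Nil
  show ?case using tangle_isotopic_refl[OF tangle_cap] by simp
next
  case (Cons a x)
  obtain i e where a: "a = (i, e)" by force
  have i: "1 \<le> i" "i < n" and x: "x \<in> braid_words n" and ie: "[(i, e)] \<in> braid_words n"
    using Cons.prems by (auto simp: braid_words_def a)
  have c: "tangle (closed_level k) [(i - 1, Cross e)] (closed_level k)" if "n \<le> k" for k
    using tangle_braid[OF braid_words_mono[OF that ie]] by simp
  have "local_move [(i - 1, Cross e), (n, Cap)] [(n, Cap), (i - 1, Cross e)]"
    using local_move.exchange[of "i - 1" "Cross e" "n - i - 1" "Cap"] i by simp
  then have 1: "tangle_isotopic (closed_level (Suc n)) (closed_level n)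
      [(i - 1, Cross e), (n, Cap)] [(n, Cap), (i - 1, Cross e)]"
    using tangle_append[OF c tangle_cap, of n] tangle_append[OF tangle_cap c, of n]
    by (intro tangle_isotopic_move) auto
  have "tangle_isotopic (closed_level (Suc n)) (closed_level n)
      ((i - 1, Cross e) # crossings x @ [(n, Cap)])
      ((i - 1, Cross e) # (n, Cap) # crossings x)"
    using tangle_isotopic_context[OF c[of "Suc n"] Cons.IH[OF x] tangle.Nil] by simp
  also have "tangle_isotopic (closed_level (Suc n)) (closed_level n)
      ((i - 1, Cross e) # (n, Cap) # crossings x)
      ((n, Cap) # (i - 1, Cross e) # crossings x)"
    using tangle_isotopic_context[OF tangle.Nil 1 tangle_braid[OF x]] by simp
  finally show ?case by (simp add: a)
qed

text \<open>
  The strand that crosses the left leg of the cap slides over to its right leg. The crossing then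
  lies between the two ends of the cup, where the first Reidemeister move removes it; a zigzag
  remains.
\<close>

lemma kink_straightens:
  "tangle_isotopic (closed_level (Suc m)) (closed_level (Suc m))
     [(Suc m, Cup True), (m, Cross e), (Suc m, Cap)] []"
proof -
  let ?T = "replicate m True" and ?F = "replicate (Suc m) False"
  have s: "closed_level (Suc m) = ?T @ [True] @ ?F"
    by (simp add: replicate_app_Cons_same)
  have cup: "tangle (?T @ [True] @ ?F) [(Suc m, Cup u)] (?T @ [True, u, \<not> u] @ ?F)" for u
    using tangle_single[OF slice.cup[of "?T @ [True]" ?F u]] by simp
  have low: "tangle (?T @ [True, True, False] @ ?F) [(m, Cross r)] (?T @ [True, True, False] @ ?F)" for r
    using tangle_single[OF slice.cross[of ?T True True "False # ?F" r]] by simp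
  have high: "tangle (?T @ [True, True, False] @ ?F) [(Suc m, Cross r)] (?T @ [True, False, True] @ ?F)" for r
    using tangle_single[OF slice.cross[of "?T @ [True]" True False ?F r]] by simp
  have cap_right: "tangle (?T @ [True, True, False] @ ?F) [(Suc m, Cap)] (?T @ [True] @ ?F)"
    using tangle_single[OF slice.cap[of "?T @ [True]" True ?F]] by simp
  have cap_left: "tangle (?T @ [True, False, True] @ ?F) [(m, Cap)] (?T @ [True] @ ?F)"
    using tangle_single[OF slice.cap[of ?T True "True # ?F"]] by simp
  have cupT: "tangle (?T @ [True] @ ?F) [(Suc m, Cup True)] (?T @ [True, True, False] @ ?F)"
    using cup[of True] by simp
  have cupF: "tangle (?T @ [True] @ ?F) [(Suc m, Cup False)] (?T @ [True, False, True] @ ?F)"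
    using cup[of False] by simp
  have "tangle_isotopic (?T @ [True, True, False] @ ?F) (?T @ [True] @ ?F)
      [(m, Cross e), (Suc m, Cap)] [(Suc m, Cross (\<not> e)), (m, Cap)]"
    using tangle_append[OF low cap_right] tangle_append[OF high cap_left]
    by (intro tangle_isotopic_move local_move.slide_cap) auto
  from tangle_isotopic_context[OF cupT this tangle.Nil]
  have "tangle_isotopic (?T @ [True] @ ?F) (?T @ [True] @ ?F)
      [(Suc m, Cup True), (m, Cross e), (Suc m, Cap)] [(Suc m, Cup True), (Suc m, Cross (\<not> e)), (m, Cap)]"
    by simp
  also have "tangle_isotopic (?T @ [True] @ ?F) (?T @ [True, False, True] @ ?F)
      [(Suc m, Cup True), (Suc m, Cross (\<not> e))] [(Suc m, Cup (\<not> True))]"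
    using tangle_append[OF cupT high] cupF
    by (intro tangle_isotopic_move local_move.R1_cup) auto
  from tangle_isotopic_context[OF tangle.Nil this cap_left]
  have "tangle_isotopic (?T @ [True] @ ?F) (?T @ [True] @ ?F)
      [(Suc m, Cup True), (Suc m, Cross (\<not> e)), (m, Cap)] [(Suc m, Cup False), (m, Cap)]"
    by simp
  also have "tangle_isotopic (?T @ [True] @ ?F) (?T @ [True] @ ?F) [(Suc m, Cup False), (m, Cap)] []"
    using tangle_append[OF cupF cap_left]
    by (intro tangle_isotopic_move local_move.zigzag_right tangle.Nil) auto
  finally show ?thesis unfolding s .
qed

text \<open>
  The Markov move for a crossing anywhere in the word: since \<open>x\<close> and \<open>y\<close> do not involve the last
  strand, its closing arc shrinks to the crossing and becomes a kink there.
\<close>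

lemma markov_destabilization:
  assumes x: "x \<in> braid_words (Suc m)" and y: "y \<in> braid_words (Suc m)"
  shows "isotopic (closure_diagram (Suc (Suc m)) (x @ [(Suc m, e)] @ y)) (closure_diagram (Suc m) (x @ y))"
proof -
  let ?N = "Suc m"
  let ?s = "closed_level ?N" and ?t = "closed_level (Suc ?N)"
  have y': "tangle ?t (crossings y) ?t"
    by (rule tangle_braid[OF braid_words_mono[OF _ y]]) simp
  have c: "tangle ?t [(m, Cross e)] ?t"
    using tangle_braid[of "[(?N, e)]" "Suc ?N"] by (simp add: braid_words_def)
  have "tangle_isotopic ?s ?s
      ((?N, Cup True) # crossings x @ [(m, Cross e)] @ crossings y @ [(?N, Cap)])
      (crossings x @ [(?N, Cup True), (m, Cross e)] @ crossings y @ [(?N, Cap)])"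
    using tangle_isotopic_context[OF tangle.Nil cup_past_crossings[OF x]
        tangle_append[OF c tangle_append[OF y' tangle_cap]]] by simp
  also have "tangle_isotopic ?s ?s
      (crossings x @ [(?N, Cup True), (m, Cross e)] @ crossings y @ [(?N, Cap)])
      (crossings x @ [(?N, Cup True), (m, Cross e), (?N, Cap)] @ crossings y)"
    using tangle_isotopic_context[OF tangle_append[OF tangle_braid[OF x] tangle_append[OF tangle_cup c]]
        cap_past_crossings[OF y] tangle.Nil] by simp
  also have "tangle_isotopic ?s ?s
      (crossings x @ [(?N, Cup True), (m, Cross e), (?N, Cap)] @ crossings y)
      (crossings x @ [] @ crossings y)"
    by (rule tangle_isotopic_context[OF tangle_braid[OF x] kink_straightens tangle_braid[OF y]])
  finally have "isotopic
      (map (\<lambda>k. (k, Cup True)) [0..<?N] @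
        ((?N, Cup True) # crossings x @ [(m, Cross e)] @ crossings y @ [(?N, Cap)]) @ map (\<lambda>k. (k, Cap)) (rev [0..<?N]))
      (map (\<lambda>k. (k, Cup True)) [0..<?N] @ (crossings x @ [] @ crossings y) @ map (\<lambda>k. (k, Cap)) (rev [0..<?N]))"
    using tangle_cups[of ?N] tangle_caps[of ?N] unfolding tangle_isotopic_def by blast
  then show ?thesis by (simp add: closure_diagram_def)
qed

lemma skein_triple_closure:
  assumes "x \<in> braid_words n" "y \<in> braid_words n" "1 \<le> i" "i < n"
  shows "skein_triple (closure_diagram n (x @ [(i, True)] @ y))
           (closure_diagram n (x @ [(i, False)] @ y)) (closure_diagram n (x @ y))"
proof -
  let ?xs = "replicate (i - 1) True" and ?ys = "replicate (n - i - 1) True @ replicate n False"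
  have s: "closed_level n = ?xs @ [True, True] @ ?ys"
  proof -
    have "n = (i - 1) + (2 + (n - i - 1))" using assms by simp
    then have "replicate n True = ?xs @ replicate 2 True @ replicate (n - i - 1) True"
      by (metis replicate_add)
    then show ?thesis by (simp add: numeral_2_eq_2)
  qed
  have "tangle [] (map (\<lambda>k. (k, Cup True)) [0..<n] @ crossings x) (?xs @ [True, True] @ ?ys)"
    "tangle (?xs @ [True, True] @ ?ys) (crossings y @ map (\<lambda>k. (k, Cap)) (rev [0..<n])) []"
    unfolding s[symmetric]
    by (rule tangle_append[OF tangle_cups tangle_braid[OF assms(1)]],
        rule tangle_append[OF tangle_braid[OF assms(2)] tangle_caps])
  from skein_triple.intros[OF this] show ?thesis
    by (simp add: closure_diagram_def smoothing_def)
qed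

lemma pos_append: "pos (x @ y) = pos x @ pos y"
  by (simp add: pos_def)

lemma braid_words_append: "x @ y \<in> braid_words n \<longleftrightarrow> x \<in> braid_words n \<and> y \<in> braid_words n"
  by (auto simp: braid_words_def)

lemma pos_in_braid_words: "pos w \<in> braid_words (Suc m) \<longleftrightarrow> set w \<subseteq> {1..m}"
  by (simp add: braid_words_def pos_def image_image atLeastLessThanSuc_atLeastAtMost)

lemma isotopic_positive_relation:
  assumes "positive_relation u w" "set u \<subseteq> {1..m}"
  shows "isotopic (closure_diagram (Suc m) (pos u)) (closure_diagram (Suc m) (pos w))"
  using assms(1)
proof cases
  case (1 a b x y)
  have words: "pos x @ pos a @ pos y \<in> braid_words (Suc m)" "pos x @ pos b @ pos y \<in> braid_words (Suc m)"
    using assms(2) positive_relation_set[OF assms(1)] 1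
    by (simp_all only: pos_append[symmetric] pos_in_braid_words)
  from 1(3) have "braid_relation (pos a) (pos b) \<or> braid_relation (pos b) (pos a)"
    by (auto intro: braid_relation.artin)
  then have "braid_step (Suc m) (pos u) (pos w) \<or> braid_step (Suc m) (pos w) (pos u)"
    unfolding 1(1,2) pos_append using words braid_step.intros by blast
  then show ?thesis using braid_step_isotopic isotopic_sym by blast
qed

section \<open>Extreme coefficients of the Homflypt polynomial\<close>

lemma lookup_monomial_times:
  fixes p :: laurent
  shows "Poly_Mapping.lookup (Poly_Mapping.single a 1 * p) k = Poly_Mapping.lookup p (k - a)"
proof -
  have shift: "k = a + q \<longleftrightarrow> q = k - a" for q by auto
  have "(\<Sum>l. (1 when a = l) * g l) = g a" for g :: "int \<times> int \<Rightarrow> int"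
    using Sum_any_when_equal'[of g a] by (simp only: when_mult mult_1)
  then show ?thesis
    unfolding lookup_mult lookup_single by (simp only: shift Sum_any_when_equal)
qed

context
  fixes P :: "link \<Rightarrow> laurent"
  assumes P: "homflypt P"
begin

text \<open>
  The coefficient of \<open>v ^ k z ^ l\<close> for the closure on \<open>Suc m\<close> strands; with this shift the degree bounds are
  \<open>length w - m\<close> and \<open>length w + m\<close>.
\<close>

abbreviation closure_coeff :: "nat \<Rightarrow> braid_word \<Rightarrow> int \<Rightarrow> int \<Rightarrow> int" where
  "closure_coeff m w k l \<equiv> Poly_Mapping.lookup (P (link_of (closure_diagram (Suc m) w))) (k, l)"

lemma closure_coeff_isotopic:
  "isotopic (closure_diagram (Suc m) u) (closure_diagram (Suc m') w) \<Longrightarrow>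
   closure_coeff m u k l = closure_coeff m' w k l"
  by (simp flip: link_of_eq_iff)

lemma closure_coeff_skein:
  assumes "x \<in> braid_words (Suc m)" "y \<in> braid_words (Suc m)" "1 \<le> i" "i \<le> m"
  shows "closure_coeff m (x @ [(i, True)] @ y) (k + 1) l - closure_coeff m (x @ [(i, False)] @ y) (k - 1) l
       = closure_coeff m (x @ y) k (l - 1)"
proof -
  have "lv_inv * P (link_of (closure_diagram (Suc m) (x @ [(i, True)] @ y)))
      - lv * P (link_of (closure_diagram (Suc m) (x @ [(i, False)] @ y)))
      = lz * P (link_of (closure_diagram (Suc m) (x @ y)))"
    using P skein_triple_closure[of x "Suc m" y i] assms by (simp add: homflypt_def)
  from arg_cong[OF this, of "\<lambda>p. Poly_Mapping.lookup p (k, l)"] show ?thesis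
    by (simp add: lookup_minus lv_def lv_inv_def lz_def lookup_monomial_times)
qed

lemma closure_coeff_square:
  assumes "set (x @ [i] @ y) \<subseteq> {1..m}"
  shows "closure_coeff m (pos (x @ [i, i] @ y)) k l =
    closure_coeff m (pos (x @ y)) (k - 2) l + closure_coeff m (pos (x @ [i] @ y)) (k - 1) (l - 1)"
proof -
  let ?n = "Suc m"
  have xi: "pos (x @ [i]) \<in> braid_words ?n" and y: "pos y \<in> braid_words ?n" and i: "1 \<le> i" "i \<le> m"
    using assms by (auto simp: pos_in_braid_words)
  have x: "pos x \<in> braid_words ?n" and ii: "[(i, True), (i, \<not> True)] \<in> braid_words ?n"
    using xi i by (simp_all add: pos_append braid_words_append) (simp add: braid_words_def)
  have "braid_step ?n (pos x @ [(i, True), (i, \<not> True)] @ pos y) (pos x @ [] @ pos y)"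
    using x y ii by (intro braid_step.intros braid_relation.cancel) (simp_all add: braid_words_append, simp add: braid_words_def)
  then have "closure_coeff m (pos (x @ [i]) @ [(i, False)] @ pos y) (k - 2) l = closure_coeff m (pos (x @ y)) (k - 2) l"
    by (intro closure_coeff_isotopic) (auto dest: braid_step_isotopic simp: pos_def)
  then show ?thesis
    using closure_coeff_skein[OF xi y i, of "k - 1" l] by (simp add: pos_def)
qed

lemma closure_coeff_stabilize:
  assumes "x \<in> braid_words (Suc m)" "y \<in> braid_words (Suc m)"
  shows "closure_coeff (Suc m) (x @ [(Suc m, e)] @ y) k l = closure_coeff m (x @ y) k l"
  by (rule closure_coeff_isotopic[OF markov_destabilization[OF assms]])

text \<open>
  Both signs of a crossing with the new strand give the same link as \<open>w\<close>, and its smoothing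
  splits off an unknot.
\<close>

lemma closure_coeff_split:
  assumes "w \<in> braid_words (Suc m)"
  shows "closure_coeff (Suc m) w k l = closure_coeff m w (k + 1) (l + 1) - closure_coeff m w (k - 1) (l + 1)"
proof -
  have nil: "[] \<in> braid_words n" for n by (simp add: braid_words_def)
  have w: "w \<in> braid_words (Suc (Suc m))" by (rule braid_words_mono[OF _ assms]) simp
  show ?thesis
    using closure_coeff_skein[OF w nil, of "Suc m" k "l + 1"] closure_coeff_stabilize[OF assms nil] by simp
qed

lemma closure_coeff_relation:
  "positive_relation u w \<Longrightarrow> set u \<subseteq> {1..m} \<Longrightarrow> closure_coeff m (pos u) k l = closure_coeff m (pos w) k l"
  by (intro closure_coeff_isotopic isotopic_positive_relation)

lemma closure_coeff_trivial: "closure_coeff 0 [] k l = (if k = 0 \<and> l = 0 then 1 else 0)"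
proof -
  have "P (link_of (closure_diagram (Suc 0) [])) = 1"
    using P by (simp add: homflypt_def unknot_def closure_diagram_def)
  then show ?thesis by (simp add: lookup_one zero_prod_def)
qed

text \<open>
  The upper and lower bounds of the MFW inequality, for positive words. The two summands of a
  square fit the same bounds because the factors \<open>v^2\<close> and \<open>v\<close> compensate the lost letters. A
  split strand widens the range by one in both directions; a stabilization, which also adds a
  letter, leaves the lower bound as it is and makes the upper one strict.
\<close>

lemma v_degree_bounds:
  assumes "set w \<subseteq> {1..m}"
  shows "closure_coeff m (pos w) k l \<noteq> 0 \<Longrightarrow>
    int (length w) - int m \<le> k \<and> k \<le> int (length w) + int m"
  using assms
proof (induction m w arbitrary: k l rule: positive_word_induct)
  case empty
  then show ?case by (simp add: pos_def closure_coeff_trivial split: if_splits)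
next
  case (relation m w w')
  then show ?case using closure_coeff_relation positive_relation_length by metis
next
  case (square m x i y)
  then consider "closure_coeff m (pos (x @ y)) (k - 2) l \<noteq> 0"
    | "closure_coeff m (pos (x @ [i] @ y)) (k - 1) (l - 1) \<noteq> 0"
    by (metis closure_coeff_square add.right_neutral)
  then show ?case
  proof cases
    case 1
    from square.IH(1)[OF this] show ?thesis by simp
  next
    case 2
    from square.IH(2)[OF this] show ?thesis by simp
  qed
next
  case (split m w)
  then have "pos w \<in> braid_words (Suc m)" by (auto simp: pos_in_braid_words)
  from closure_coeff_split[OF this, of k l] split.prems
  consider "closure_coeff m (pos w) (k + 1) (l + 1) \<noteq> 0" | "closure_coeff m (pos w) (k - 1) (l + 1) \<noteq> 0"
    by fastforce
  then show ?case by cases (auto dest: split.IH)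
next
  case (stabilize m x y)
  then have "pos x \<in> braid_words (Suc m)" "pos y \<in> braid_words (Suc m)"
    by (auto simp: pos_in_braid_words)
  from closure_coeff_stabilize[OF this, of True k l] stabilize.prems
  have "closure_coeff m (pos (x @ y)) k l \<noteq> 0" by (simp add: pos_def)
  from stabilize.IH[OF this] show ?case by simp
qed

text \<open>
  With the sign \<open>(-1) ^ m\<close> both extreme coefficients obey the same recursion, up to a power of \<open>z\<close>; only
  stabilization tells them apart.
\<close>

definition lowest :: "nat \<Rightarrow> nat list \<Rightarrow> int \<Rightarrow> int" where
  "lowest m w l = closure_coeff m (pos w) (int (length w) - int m) l"

definition highest :: "nat \<Rightarrow> nat list \<Rightarrow> int \<Rightarrow> int" where
  "highest m w l = (- 1) ^ m * closure_coeff m (pos w) (int (length w) + int m) l"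

lemma extremes_empty:
  "lowest 0 [] l = (if l = 0 then 1 else 0)" "highest 0 [] l = (if l = 0 then 1 else 0)"
  by (simp_all add: lowest_def highest_def pos_def closure_coeff_trivial)

lemma extremes_relation:
  assumes "positive_relation u w" "set u \<subseteq> {1..m}"
  shows "lowest m w = lowest m u" "highest m w = highest m u"
  using closure_coeff_relation[OF assms] positive_relation_length[OF assms(1)]
  by (simp_all add: lowest_def highest_def fun_eq_iff)

lemma extremes_square:
  assumes "set (x @ [i] @ y) \<subseteq> {1..m}"
  shows "lowest m (x @ [i, i] @ y) l = lowest m (x @ y) l + lowest m (x @ [i] @ y) (l - 1)"
    and "highest m (x @ [i, i] @ y) l = highest m (x @ y) l + highest m (x @ [i] @ y) (l - 1)"
  unfolding lowest_def highest_def closure_coeff_square[OF assms]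
  by (simp_all add: algebra_simps)

lemma extremes_split:
  assumes "set w \<subseteq> {1..m}"
  shows "lowest (Suc m) w l = lowest m w (l + 1)" "highest (Suc m) w l = highest m w (l + 1)"
proof -
  let ?c = "int (length w)"
  have w: "pos w \<in> braid_words (Suc m)"
    using assms by (auto simp: pos_in_braid_words)
  have "closure_coeff m (pos w) (?c - int m - 2) (l + 1) = 0" "closure_coeff m (pos w) (?c + int m + 2) (l + 1) = 0"
    using v_degree_bounds[OF assms, of "?c - int m - 2"] v_degree_bounds[OF assms, of "?c + int m + 2"] by force+
  then show "lowest (Suc m) w l = lowest m w (l + 1)" "highest (Suc m) w l = highest m w (l + 1)"
    using closure_coeff_split[OF w, of "?c - int (Suc m)" l] closure_coeff_split[OF w, of "?c + int (Suc m)" l]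
    by (simp_all add: lowest_def highest_def algebra_simps)
qed

lemma extremes_stabilize:
  assumes "set (x @ y) \<subseteq> {1..m}"
  shows "lowest (Suc m) (x @ [Suc m] @ y) l = lowest m (x @ y) l" "highest (Suc m) (x @ [Suc m] @ y) l = 0"
proof -
  let ?c = "int (length (x @ y))"
  have xy: "pos x \<in> braid_words (Suc m)" "pos y \<in> braid_words (Suc m)"
    using assms by (auto simp: pos_in_braid_words)
  have coeff: "closure_coeff (Suc m) (pos (x @ [Suc m] @ y)) k l = closure_coeff m (pos (x @ y)) k l" for k
    using closure_coeff_stabilize[OF xy, of True k l] by (simp add: pos_def)
  have "closure_coeff m (pos (x @ y)) (?c + int m + 2) l = 0"
    using v_degree_bounds[OF assms, of "?c + int m + 2" l] by force
  then show "lowest (Suc m) (x @ [Suc m] @ y) l = lowest m (x @ y) l" "highest (Suc m) (x @ [Suc m] @ y) l = 0"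
    unfolding lowest_def highest_def coeff by (simp_all add: algebra_simps)
qed

lemma extremes_nonneg:
  assumes "set w \<subseteq> {1..m}"
  shows "lowest m w l \<ge> 0 \<and> highest m w l \<ge> 0"
  using assms
proof (induction m w arbitrary: l rule: positive_word_induct)
  case (relation m w w')
  then show ?case using extremes_relation by metis
next
  case (square m x i y)
  then show ?case by (simp only: extremes_square) simp
qed (simp_all only: extremes_empty extremes_split extremes_stabilize, simp_all)

lemma lowest_nonzero:
  assumes "set w \<subseteq> {1..m}"
  shows "\<exists>l. lowest m w l > 0"
  using assms
proof (induction m w rule: positive_word_induct)
  case empty
  then show ?case by (auto simp: extremes_empty)
next
  case (relation m w w')
  then show ?case using extremes_relation by metis
next
  case (square m x i y)
  then obtain l where "lowest m (x @ y) l > 0" by blast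
  moreover have "lowest m (x @ [i] @ y) (l - 1) \<ge> 0" using extremes_nonneg square.hyps by blast
  ultimately show ?case using extremes_square(1)[OF square.hyps, of l] by (metis add_pos_nonneg)
next
  case (split m w)
  then obtain l where "lowest m w l > 0" by blast
  then have "lowest (Suc m) w (l - 1) > 0" using extremes_split split by simp
  then show ?case by blast
next
  case (stabilize m x y)
  then show ?case using extremes_stabilize(1)[OF stabilize.hyps] by simp
qed

text \<open>
  The two summands cannot cancel, which makes inserting a square and doubling a letter safe, and
  one of these two steps produces the square whenever the coefficient is nonzero.
\<close>

lemma highest_square_nonzero_iff:
  assumes "set (x @ [i] @ y) \<subseteq> {1..m}"
  shows "(\<exists>l. highest m (x @ [i, i] @ y) l \<noteq> 0) \<longleftrightarrow> (\<exists>l. highest m (x @ y) l \<noteq> 0) \<or> (\<exists>l. highest m (x @ [i] @ y) l \<noteq> 0)"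
proof -
  have "highest m (x @ y) l \<ge> 0" "highest m (x @ [i] @ y) l \<ge> 0" for l
    using extremes_nonneg assms by simp_all
  then have "highest m (x @ [i, i] @ y) l \<noteq> 0 \<longleftrightarrow> highest m (x @ y) l \<noteq> 0 \<or> highest m (x @ [i] @ y) (l - 1) \<noteq> 0" for l
    unfolding extremes_square(2)[OF assms] by (simp add: add_nonneg_eq_0_iff)
  then show ?thesis by (metis add_diff_cancel_right')
qed

lemma highest_empty_nonzero: "\<exists>l. highest m [] l \<noteq> 0"
proof (induction m)
  case 0
  then show ?case by (auto simp: extremes_empty)
next
  case (Suc m)
  then obtain l where "highest m [] l \<noteq> 0" by blast
  then have "highest (Suc m) [] (l - 1) \<noteq> 0" by (simp add: extremes_split)
  then show ?case by blast
qed

lemma obtainable_imp_highest_nonzero: "obtainable (Suc m) w \<Longrightarrow> \<exists>l. highest m w l \<noteq> 0"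
proof (induction rule: obtainable.induct)
  case empty
  show ?case by (rule highest_empty_nonzero)
next
  case (insert x y i)
  then have "set (x @ [i] @ y) \<subseteq> {1..m}"
    using obtainable_positive[OF insert.hyps(1)] by (auto simp: less_Suc_eq_le)
  then show ?case using highest_square_nonzero_iff insert.IH by blast
next
  case (double x i y)
  then have "set (x @ [i] @ y) \<subseteq> {1..m}"
    using obtainable_positive[OF double.hyps] by (auto simp: less_Suc_eq_le)
  then show ?case using highest_square_nonzero_iff double.IH by blast
next
  case (relation w w')
  then have "set w \<subseteq> {1..m}"
    using obtainable_positive[OF relation.hyps(1)] by (auto simp: less_Suc_eq_le)
  then show ?case using extremes_relation(2)[OF relation.hyps(2)] relation.IH by simp
qed

lemma highest_nonzero_imp_obtainable:
  assumes "set w \<subseteq> {1..m}"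
  shows "\<exists>l. highest m w l \<noteq> 0 \<Longrightarrow> obtainable (Suc m) w"
  using assms
proof (induction m w rule: positive_word_induct)
  case empty
  show ?case by (rule obtainable.empty)
next
  case (relation m w w')
  then show ?case using extremes_relation(2) obtainable.relation by metis
next
  case (square m x i y)
  have i: "1 \<le> i" "i < Suc m" using square.hyps by auto
  from square.prems show ?case
    unfolding highest_square_nonzero_iff[OF square.hyps]
    using square.IH i obtainable.insert obtainable.double by blast
next
  case (split m w)
  then show ?case using extremes_split(2)[OF split.hyps] obtainable_more_strands by fastforce
next
  case (stabilize m x y)
  then show ?case using extremes_stabilize(2) by blast
qed

lemma MFW_sharp_iff_obtainable:
  assumes "set w \<subseteq> {1..m}"
  shows "MFW P (link_of (closure_diagram (Suc m) (pos w))) = of_nat (Suc m) \<longleftrightarrow> obtainable (Suc m) w"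
proof -
  define p where "p = P (link_of (closure_diagram (Suc m) (pos w)))"
  define K where "K = fst ` Poly_Mapping.keys p"
  let ?c = "int (length w)"
  have K: "k \<in> K \<longleftrightarrow> (\<exists>l. closure_coeff m (pos w) k l \<noteq> 0)" for k
    by (simp add: K_def p_def image_iff in_keys_iff Bex_def)
  have fin: "finite K" by (simp add: K_def)
  have bounds: "?c - int m \<le> k" "k \<le> ?c + int m" if "k \<in> K" for k
    using that v_degree_bounds[OF assms] K by blast+
  have low: "?c - int m \<in> K"
    using lowest_nonzero[OF assms] unfolding K lowest_def by (metis less_irrefl)
  have Min: "Min K = ?c - int m"
    using fin bounds low by (intro Min_eqI) auto
  have "K \<noteq> {}" using low by blast
  then have "Max K \<in> K" using fin by (rule Max_in[rotated])
  then have Max: "Max K = ?c + int m \<longleftrightarrow> ?c + int m \<in> K"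
    using fin bounds by (auto intro!: Max_eqI)
  have "MFW P (link_of (closure_diagram (Suc m) (pos w))) = of_nat (Suc m) \<longleftrightarrow>
      rat_of_int (Max K - Min K) = of_int (2 * int m)"
    by (simp add: MFW_def max_v_degree_def min_v_degree_def K_def p_def field_simps)
  also have "\<dots> \<longleftrightarrow> Max K = ?c + int m"
    unfolding of_int_eq_iff Min by auto
  also have "\<dots> \<longleftrightarrow> (\<exists>l. highest m w l \<noteq> 0)"
    by (simp add: Max K highest_def)
  also have "\<dots> \<longleftrightarrow> obtainable (Suc m) w"
    using obtainable_imp_highest_nonzero highest_nonzero_imp_obtainable[OF assms] by blast
  finally show ?thesis .
qed

end

section \<open>Sharpness of the MFW inequality\<close>

theorem corollary5:
  fixes n :: nat and b :: braid and P :: "link \<Rightarrow> laurent"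
  assumes "n \<ge> 1"
    and "b \<in> braid_group n"
    and "positive_braid n b"
    and "homflypt P"
  shows "(MFW P (braid_closure n b) = of_nat n \<longleftrightarrow>
            (\<exists>w \<in> positive_words_of n b. obtainable n w))
       \<and> ((\<exists>w \<in> positive_words_of n b. obtainable n w) \<longleftrightarrow>
            (\<forall>w \<in> positive_words_of n b. obtainable n w))"
proof -
  obtain m where n: "n = Suc m" using assms(1) by (cases n) auto
  have "MFW P (braid_closure n b) = of_nat n \<longleftrightarrow> obtainable n w" if "w \<in> positive_words_of n b" for w
  proof -
    have "set w \<subseteq> {1..m}" and b: "b = braid_of n (pos w)"
      using that by (auto simp: positive_words_of_def positive_words_def n less_Suc_eq_le)
    then show ?thesis
      using MFW_sharp_iff_obtainable[OF assms(4)] by (simp only: b braid_closure_eq n)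
  qed
  moreover have "positive_words_of n b \<noteq> {}" using assms(3) by (simp add: positive_braid_def)
  ultimately show ?thesis by blast
qed

end
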